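(* Let $(\mathfrak{L},[\;,\;])$ be the Witt algebra over $\mathbb{C}$, with basis $\{e_i\}_{i\in\mathbb{Z}}$, and let $(\mathfrak{L},\cdot,[\;,\;])$ be a transposed Poisson algebra structure defined on it. Then $(\mathfrak{L},\cdot,[\;,\;])$ is not a Poisson algebra, and $(\mathfrak{L},\cdot)$ is a mutation of the algebra of Laurent polynomials; that is, there is $w$ in the span of $\{e_i\}_{i\in\mathbb{Z}}$ such that $e_i\cdot e_j=e_i\,w\,e_j$ for all $i,j\in\mathbb{Z}$, where juxtaposition is the Laurent polynomial product $e_ie_j=e_{i+j}$. Conversely, every nonzero mutation of the algebra of Laurent polynomials gives, together with the Witt bracket on the same vector space, a transposed Poisson algebra whose Lie part is the Witt algebra.
   Context: The Witt algebra has basis $\{e_i\}_{i\in\mathbb{Z}}$ and bracket $[e_i,e_j]=(i-j)e_{i+j}$. The algebra of Laurent polynomials is realized on the same vector space with product $e_ie_j=e_{i+j}$. The mutation of a commutative associative algebra $A$ by an element $p\in A$ is the vector space $A$ with product $x\cdot_p y=x\,p\,y$. A transposed Poisson algebra is a vector space $\mathfrak{L}$ with two nonzero bilinear operations $\cdot$ and $[\;,\;]$ such that $(\mathfrak{L},\cdot)$ is commutative and associative, $(\mathfrak{L},[\;,\;])$ is a Lie algebra, and $2z\cdot[x,y]=[z\cdot x,y]+[x,z\cdot y]$ for all $x,y,z$. A triple $(\mathfrak{L},\cdot,[\;,\;])$ with $\cdot$ commutative associative and $[\;,\;]$ Lie is a Poisson algebra if $[x,y\cdot z]=[x,y]\cdot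 z+y\cdot[x,z]$ for all $x,y,z$. *)

theory Defs
  imports Complex_Main "HOL-Library.Poly_Mapping"
begin

locale bilinear_product = vector_space scale
  for scale :: "'k::field \<Rightarrow> 'v::ab_group_add \<Rightarrow> 'v"
    and mult :: "'v \<Rightarrow> 'v \<Rightarrow> 'v" +
  assumes linear_left: "Vector_Spaces.linear scale scale (\<lambda>x. mult x y)"
    and linear_right: "Vector_Spaces.linear scale scale (\<lambda>y. mult x y)"

locale comm_assoc_algebra = bilinear_product scale mult
  for scale :: "'k::field \<Rightarrow> 'v::ab_group_add \<Rightarrow> 'v"
    and mult :: "'v \<Rightarrow> 'v \<Rightarrow> 'v" +
  assumes commutative: "mult x y = mult y x"
    and associative: "mult (mult x y) z = mult x (mult y z)"

locale lie_algebra = bilinear_product scale bracket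
  for scale :: "'k::field \<Rightarrow> 'v::ab_group_add \<Rightarrow> 'v"
    and bracket :: "'v \<Rightarrow> 'v \<Rightarrow> 'v" +
  assumes alternating: "bracket x x = 0"
    and jacobi: "bracket x (bracket y z) + bracket y (bracket z x) + bracket z (bracket x y) = 0"

locale transposed_poisson_algebra =
  comm_assoc_algebra scale mult + lie_algebra scale bracket
  for scale :: "'k::field \<Rightarrow> 'v::ab_group_add \<Rightarrow> 'v"
    and mult bracket :: "'v \<Rightarrow> 'v \<Rightarrow> 'v" +
  assumes mult_nonzero: "\<exists>x y. mult x y \<noteq> 0"
    and bracket_nonzero: "\<exists>x y. bracket x y \<noteq> 0"
    and transposed_leibniz:
      "scale 2 (mult z (bracket x y)) = bracket (mult z x) y + bracket x (mult z y)"

locale poisson_algebra =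
  comm_assoc_algebra scale mult + lie_algebra scale bracket
  for scale :: "'k::field \<Rightarrow> 'v::ab_group_add \<Rightarrow> 'v"
    and mult bracket :: "'v \<Rightarrow> 'v \<Rightarrow> 'v" +
  assumes leibniz:
    "bracket x (mult y z) = mult (bracket x y) z + mult y (bracket x z)"

text \<open>The mutation of an algebra, given by its product, by an element \<open>p\<close>.\<close>

definition mutation :: "('v \<Rightarrow> 'v \<Rightarrow> 'v) \<Rightarrow> 'v \<Rightarrow> 'v \<Rightarrow> 'v \<Rightarrow> 'v" where
  "mutation mult p x y = mult (mult x p) y"

text \<open>Laurent polynomials are the finitely supported coefficient functions on the integers;
  the product \<open>(*)\<close> of this type is convolution, so that \<open>e\<^sub>i e\<^sub>j = e\<^sub>i\<^sub>+\<^sub>j\<close>.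
  The Witt algebra is the bracket \<open>witt_bracket\<close> on this same vector space.\<close>

type_synonym laurent = "int \<Rightarrow>\<^sub>0 complex"

definition laurent_scale :: "complex \<Rightarrow> laurent \<Rightarrow> laurent" where
  "laurent_scale c x = Poly_Mapping.map ((*) c) x"

definition witt_e :: "int \<Rightarrow> laurent" where
  "witt_e i = Poly_Mapping.single i 1"

text \<open>The bilinear extension of \<open>[e\<^sub>i, e\<^sub>j] = (i - j) e\<^sub>i\<^sub>+\<^sub>j\<close>.\<close>

definition witt_bracket :: "laurent \<Rightarrow> laurent \<Rightarrow> laurent" where
  "witt_bracket x y =
    (\<Sum>i\<in>Poly_Mapping.keys x. \<Sum>j\<in>Poly_Mapping.keys y.
      laurent_scale (Poly_Mapping.lookup x i * Poly_Mapping.lookup y j * of_int (i - j))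
        (witt_e (i + j)))"

lemma laurent_scale_eq: "laurent_scale c x = Poly_Mapping.single 0 c * x"
  by (simp add: laurent_scale_def mult_map_scale_conv_mult)

lemma lookup_laurent_scale [simp]:
  "Poly_Mapping.lookup (laurent_scale c x) i = c * Poly_Mapping.lookup x i"
  unfolding laurent_scale_def by transfer (simp add: when_def)

lemma vector_space_laurent: "vector_space laurent_scale"
  by unfold_locales (auto intro!: poly_mapping_eqI simp: lookup_add algebra_simps)

interpretation laurent: vector_space laurent_scale
  by (rule vector_space_laurent)

lemma witt_e_mult: "witt_e i * witt_e j = witt_e (i + j)"
  by (simp add: witt_e_def mult_single)

lemma inj_witt_e: "inj witt_e"
  by (rule injI) (metis lookup_single_eq lookup_single_not_eq witt_e_def zero_neq_one)

lemma laurent_expand: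
  "x = (\<Sum>i\<in>Poly_Mapping.keys x. laurent_scale (Poly_Mapping.lookup x i) (witt_e i))"
  by (rule poly_mapping_eqI)
    (auto simp: lookup_sum witt_e_def lookup_single when_def in_keys_iff if_distrib cong: if_cong)

lemma span_witt_e: "laurent.span (range witt_e) = UNIV"
proof -
  have "x \<in> laurent.span (range witt_e)" for x
    by (subst laurent_expand)
      (intro laurent.span_sum laurent.span_scale laurent.span_base rangeI)
  then show ?thesis by auto
qed

lemma independent_witt_e: "laurent.independent (range witt_e)"
proof -
  have "u v = 0"
    if t: "finite t" "t \<subseteq> range witt_e"
      and s: "(\<Sum>v\<in>t. laurent_scale (u v) v) = 0" and v: "v \<in> t" for t u v
  proof -
    obtain i where i: "v = witt_e i" using t v by blast
    have "0 = Poly_Mapping.lookup (\<Sum>v\<in>t. laurent_scale (u v) v) i"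
      using s by simp
    also have "\<dots> = (\<Sum>w\<in>t. if w = v then u v else 0)"
      unfolding lookup_sum
    proof (rule sum.cong)
      fix w assume "w \<in> t"
      then obtain j where "w = witt_e j" using t by blast
      then show "Poly_Mapping.lookup (laurent_scale (u w) w) i = (if w = v then u v else 0)"
        using i injD[OF inj_witt_e] by (auto simp: witt_e_def lookup_single when_def)
    qed simp
    also have "\<dots> = u v" using t v by simp
    finally show ?thesis by simp
  qed
  then show ?thesis
    unfolding laurent.independent_explicit_module by blast
qed

lemma witt_bracket_superset:
  assumes "finite A" "Poly_Mapping.keys x \<subseteq> A" "finite B" "Poly_Mapping.keys y \<subseteq> B"
  shows "witt_bracket x y =
    (\<Sum>i\<in>A. \<Sum>j\<in>B.
      laurent_scale (Poly_Mapping.lookup x i * Poly_Mapping.lookup y j * of_int (i - j))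
        (witt_e (i + j)))"
proof -
  have "witt_bracket x y =
    (\<Sum>i\<in>Poly_Mapping.keys x. \<Sum>j\<in>B.
      laurent_scale (Poly_Mapping.lookup x i * Poly_Mapping.lookup y j * of_int (i - j))
        (witt_e (i + j)))"
    unfolding witt_bracket_def using assms
    by (intro sum.cong sum.mono_neutral_left) (auto simp: in_keys_iff)
  also have "\<dots> = (\<Sum>i\<in>A. \<Sum>j\<in>B.
      laurent_scale (Poly_Mapping.lookup x i * Poly_Mapping.lookup y j * of_int (i - j))
        (witt_e (i + j)))"
    using assms by (intro sum.mono_neutral_left) (auto simp: in_keys_iff)
  finally show ?thesis .
qed

lemma witt_bracket_basis:
  "witt_bracket (witt_e i) (witt_e j) = laurent_scale (of_int (i - j)) (witt_e (i + j))"
  by (subst witt_bracket_superset[of "{i}" _ "{j}"]) (auto simp: witt_e_def)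

lemma witt_bracket_add_left: "witt_bracket (x + y) z = witt_bracket x z + witt_bracket y z"
proof -
  let ?A = "Poly_Mapping.keys x \<union> Poly_Mapping.keys y \<union> Poly_Mapping.keys (x + y)"
  let ?B = "Poly_Mapping.keys z"
  show ?thesis
    by (simp add: witt_bracket_superset[of ?A _ ?B] le_supI1 Un_upper1 lookup_add
        distrib_right laurent.scale_left_distrib sum.distrib)
qed

lemma witt_bracket_scale_left:
  "witt_bracket (laurent_scale c x) y = laurent_scale c (witt_bracket x y)"
proof -
  have "Poly_Mapping.keys (laurent_scale c x) \<subseteq> Poly_Mapping.keys x"
    by (auto simp: in_keys_iff)
  then show ?thesis
    by (simp add: witt_bracket_superset[of "Poly_Mapping.keys x" _ "Poly_Mapping.keys y"]
        laurent.scale_sum_right mult.assoc)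
qed

lemma witt_bracket_swap: "witt_bracket x y = - witt_bracket y x"
proof -
  have "witt_bracket x y =
    (\<Sum>j\<in>Poly_Mapping.keys y. \<Sum>i\<in>Poly_Mapping.keys x.
      laurent_scale (Poly_Mapping.lookup x i * Poly_Mapping.lookup y j * of_int (i - j))
        (witt_e (i + j)))"
    unfolding witt_bracket_def by (rule sum.swap)
  also have "\<dots> = - witt_bracket y x"
    unfolding witt_bracket_def sum_negf[symmetric] laurent.scale_minus_left[symmetric]
    by (intro sum.cong refl) (simp add: algebra_simps)
  finally show ?thesis .
qed

lemma bilinear_witt_bracket: "bilinear_product laurent_scale witt_bracket"
proof unfold_locales
  fix x y z c
  show "witt_bracket (x + z) y = witt_bracket x y + witt_bracket z y"
    by (rule witt_bracket_add_left)
  show "witt_bracket (laurent_scale c x) y = laurent_scale c (witt_bracket x y)"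
    by (rule witt_bracket_scale_left)
  show "witt_bracket x (y + z) = witt_bracket x y + witt_bracket x z"
    using witt_bracket_add_left[of y z x]
    by (simp add: witt_bracket_swap[of x])
  show "witt_bracket x (laurent_scale c y) = laurent_scale c (witt_bracket x y)"
    using witt_bracket_scale_left[of c y x]
    by (simp add: witt_bracket_swap[of x] laurent.scale_minus_right)
qed

end

theory Submission
  imports Defs
begin

text \<open>
  Write \<open>D e\<^sub>i = i e\<^sub>i\<close> for the Euler derivation \<open>t d/dt\<close> of the Laurent polynomials. The Witt bracket
  is the Wronskian \<open>[x, y] = D x \<cdot> y - x \<cdot> D y\<close>, because both sides are bilinear and agree on basis
  vectors. Since \<open>D\<close> is a derivation of a commutative ring, the Jacobi identity and the identity
  \<open>2 u [x, y] = [u x, y] + [x, u y]\<close> become polynomial identities. This settles the converse.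

  For the direct part, the transposed Leibniz rule says that multiplication by a fixed \<open>z\<close> is a
  linear map \<open>\<phi>\<close> with \<open>2 \<phi> [x, y] = [\<phi> x, y] + [x, \<phi> y]\<close>, a half-derivation. Every such map is
  multiplication by the Laurent polynomial \<open>\<phi> 1\<close> (\<open>half_derivation_is_multiplication\<close>).
  Indeed, \<open>\<psi> x = \<phi> x - \<phi> 1 \<cdot> x\<close> is again a half-derivation, and it vanishes at \<open>1\<close>. Taking \<open>y = 1\<close>
  gives \<open>D (\<psi> e\<^sub>i) = 2 i \<psi> e\<^sub>i\<close>, so \<open>\<psi> e\<^sub>i\<close> is a multiple of \<open>e\<^sub>2\<^sub>i\<close>; comparing coefficients in the
  identity for \<open>e\<^sub>i\<close> and a suitable \<open>e\<^sub>j\<close> shows that this multiple is zero.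

  Hence the product of \<open>z\<close> and \<open>x\<close> is \<open>f z \<cdot> x\<close> for some \<open>f z\<close>, and by commutativity \<open>f z = f 1 \<cdot> z\<close>:
  the structure is the mutation by \<open>w = f 1\<close>, the product of \<open>1\<close> with itself. If it were also a Poisson
  algebra, the Leibniz rule for the bracket of \<open>x\<close> with the product of \<open>1\<close> and \<open>1\<close> would read
  \<open>D x \<cdot> w - x \<cdot> D w = 2 D x \<cdot> w\<close>. Here \<open>x = 1\<close> gives \<open>D w = 0\<close>, and then \<open>x = e\<^sub>1\<close> gives \<open>e\<^sub>1 w = 0\<close>, so
  \<open>w = 0\<close>, which a nonzero product excludes.
\<close>

section \<open>Laurent polynomials\<close>

lemma laurent_linear_induct [case_names zero basis add]:
  assumes "P 0"
    and "\<And>c i. P (laurent_scale c (witt_e i))"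
    and "\<And>x y. P x \<Longrightarrow> P y \<Longrightarrow> P (x + y)"
  shows "P x"
proof -
  have "x \<in> laurent.span (range witt_e)"
    by (simp add: span_witt_e)
  then show ?thesis
    by (induction rule: laurent.span_induct_alt) (auto intro: assms)
qed

lemma witt_e_zero: "witt_e 0 = 1"
  by (simp add: witt_e_def)

lemma laurent_scale_mult_left: "laurent_scale c x * y = laurent_scale c (x * y)"
  by (simp add: laurent_scale_eq mult.assoc)

lemma laurent_scale_mult_right: "x * laurent_scale c y = laurent_scale c (x * y)"
  by (simp add: laurent_scale_eq mult.left_commute)

lemma laurent_scale_two: "laurent_scale 2 x = x + x"
  using laurent.scale_left_distrib[of 1 1 x] by simp

lemma lookup_mult_witt_e:
  "Poly_Mapping.lookup (x * witt_e j) k = Poly_Mapping.lookup x (k - j)"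
proof (induction x rule: laurent_linear_induct)
  case (basis c i)
  show ?case
    unfolding laurent_scale_mult_left witt_e_mult
    by (auto simp: witt_e_def lookup_single when_def)
qed (simp_all add: distrib_right lookup_add)

lemma lookup_witt_e_mult:
  "Poly_Mapping.lookup (witt_e i * x) k = Poly_Mapping.lookup x (k - i)"
  by (subst mult.commute) (rule lookup_mult_witt_e)

section \<open>The Witt bracket as a Wronskian\<close>

text \<open>The derivation \<open>t d/dt\<close>. Obtaining it from the bracket makes its linearity part of the
  bilinearity of the bracket.\<close>

definition euler :: "laurent \<Rightarrow> laurent" where
  "euler x = witt_bracket x 1"

lemma euler_scale: "euler (laurent_scale c x) = laurent_scale c (euler x)"
  by (simp add: euler_def witt_bracket_scale_left)

lemma euler_add: "euler (x + y) = euler x + euler y"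
  by (simp add: euler_def witt_bracket_add_left)

lemma euler_zero: "euler 0 = 0"
  by (simp add: euler_def witt_bracket_def)

lemma euler_diff: "euler (x - y) = euler x - euler y"
  using euler_add[of "x - y" y] by simp

lemma euler_witt_e: "euler (witt_e i) = laurent_scale (of_int i) (witt_e i)"
  using witt_bracket_basis[of i 0] by (simp add: euler_def witt_e_zero)

lemma euler_one: "euler 1 = 0"
  using euler_witt_e[of 0] by (simp add: witt_e_zero)

lemma lookup_euler: "Poly_Mapping.lookup (euler x) k = of_int k * Poly_Mapping.lookup x k"
proof (induction x rule: laurent_linear_induct)
  case (basis c i)
  show ?case
    unfolding euler_scale euler_witt_e
    by (auto simp: witt_e_def lookup_single when_def)
qed (simp_all add: euler_zero euler_add lookup_add distrib_left)

lemma euler_mult: "euler (x * y) = euler x * y + x * euler y"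
proof (induction x rule: laurent_linear_induct)
  case (basis c i)
  show ?case
  proof (induction y rule: laurent_linear_induct)
    case (basis d j)
    show ?case
      by (rule poly_mapping_eqI)
        (simp add: laurent_scale_mult_left laurent_scale_mult_right witt_e_mult euler_scale
          euler_witt_e lookup_add algebra_simps)
  qed (simp_all add: euler_zero euler_add algebra_simps)
qed (simp_all add: euler_zero euler_add algebra_simps)

lemma witt_bracket_wronskian: "witt_bracket x y = euler x * y - x * euler y"
proof (induction x rule: laurent_linear_induct)
  case zero
  show ?case by (simp add: witt_bracket_def euler_zero)
next
  case (add x x')
  then show ?case by (simp add: witt_bracket_add_left euler_add algebra_simps)
next
  case (basis c i)
  show ?case
  proof (induction y rule: laurent_linear_induct)
    case zero
    show ?case by (simp add: witt_bracket_def euler_zero)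
  next
    case (add y y')
    then show ?case
      using witt_bracket_add_left[of y y' "laurent_scale c (witt_e i)"]
      by (simp add: witt_bracket_swap[of "laurent_scale c (witt_e i)"] euler_add algebra_simps)
  next
    case (basis d j)
    have "witt_bracket (witt_e i) (laurent_scale d (witt_e j)) =
        laurent_scale d (laurent_scale (of_int (i - j)) (witt_e (i + j)))"
      using witt_bracket_scale_left[of d "witt_e j" "witt_e i"]
      by (simp only: witt_bracket_swap[of "witt_e i"] laurent.scale_minus_right
          flip: witt_bracket_basis)
    then show ?case
      unfolding witt_bracket_scale_left
      by (intro poly_mapping_eqI)
        (simp add: laurent_scale_mult_left laurent_scale_mult_right
          witt_e_mult euler_scale euler_witt_e lookup_minus right_diff_distrib
          left_diff_distrib ac_simps)
  qed
qed

lemma lie_algebra_witt: "lie_algebra laurent_scale witt_bracket"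
proof -
  interpret bilinear_product laurent_scale witt_bracket
    by (rule bilinear_witt_bracket)
  show ?thesis
  proof unfold_locales
    fix x y z
    show "witt_bracket x x = 0"
      by (simp add: witt_bracket_wronskian mult.commute)
    show "witt_bracket x (witt_bracket y z) + witt_bracket y (witt_bracket z x) +
        witt_bracket z (witt_bracket x y) = 0"
      by (simp add: witt_bracket_wronskian euler_mult euler_diff algebra_simps)
  qed
qed

section \<open>Half-derivations of the Witt algebra\<close>

lemma multiplication_is_half_derivation:
  "laurent_scale 2 (u * witt_bracket x y) = witt_bracket (u * x) y + witt_bracket x (u * y)"
  by (simp add: laurent_scale_two witt_bracket_wronskian euler_mult algebra_simps)

text \<open>A half-derivation that kills \<open>1\<close> satisfies \<open>D (\<psi> e\<^sub>i) = 2 i \<psi> e\<^sub>i\<close>, which confines \<open>\<psi> e\<^sub>i\<close> to the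
  line of \<open>e\<^sub>2\<^sub>i\<close>. In the identity for \<open>e\<^sub>i\<close> and \<open>e\<^sub>j\<close> the three terms then live in degrees \<open>2 i + 2 j\<close>,
  \<open>2 i + j\<close> and \<open>i + 2 j\<close>; these are distinct for \<open>i\<close>, \<open>j\<close> nonzero and unequal, so each term vanishes.\<close>

lemma half_derivation_vanishing:
  assumes half: "\<And>x y. laurent_scale 2 (\<psi> (witt_bracket x y)) =
      witt_bracket (\<psi> x) y + witt_bracket x (\<psi> y)"
    and scale: "\<And>c x. \<psi> (laurent_scale c x) = laurent_scale c (\<psi> x)"
    and one: "\<psi> 1 = 0"
  shows "\<psi> (witt_e i) = 0"
proof (cases "i = 0")
  case True
  then show ?thesis by (simp add: witt_e_zero one)
next
  case False
  have support: "Poly_Mapping.lookup (\<psi> (witt_e i)) k = 0" if "k \<noteq> 2 * i" for i k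
  proof -
    have "laurent_scale 2 (laurent_scale (of_int i) (\<psi> (witt_e i))) = euler (\<psi> (witt_e i))"
      using half[of "witt_e i" 1]
      by (simp add: witt_bracket_wronskian euler_one one scale euler_witt_e euler_zero)
    then have "Poly_Mapping.lookup
          (laurent_scale 2 (laurent_scale (of_int i) (\<psi> (witt_e i)))) k =
        Poly_Mapping.lookup (euler (\<psi> (witt_e i))) k"
      by simp
    then have "of_int (2 * i - k) * Poly_Mapping.lookup (\<psi> (witt_e i)) k = 0"
      by (simp add: lookup_euler algebra_simps)
    with that show ?thesis by (metis eq_iff_diff_eq_0 mult_eq_0_iff of_int_eq_0_iff)
  qed
  \<comment> \<open>Besides separating the three degrees, \<open>j\<close> must differ from \<open>2 i\<close>, because the coefficient in
    degree \<open>2 i + j\<close> carries the factor \<open>2 i - j\<close>.\<close>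
  define j where "j = - i"
  have j: "j \<noteq> 0" "j \<noteq> i" "j \<noteq> 2 * i"
    using False by (auto simp: j_def)
  have "laurent_scale 2 (laurent_scale (of_int (i - j)) (\<psi> (witt_e (i + j)))) =
      witt_bracket (\<psi> (witt_e i)) (witt_e j) + witt_bracket (witt_e i) (\<psi> (witt_e j))"
    using half[of "witt_e i" "witt_e j"] by (simp add: witt_bracket_basis scale)
  then have "Poly_Mapping.lookup
        (laurent_scale 2 (laurent_scale (of_int (i - j)) (\<psi> (witt_e (i + j))))) (2 * i + j) =
      Poly_Mapping.lookup
        (witt_bracket (\<psi> (witt_e i)) (witt_e j) + witt_bracket (witt_e i) (\<psi> (witt_e j)))
        (2 * i + j)"
    by simp
  moreover have "Poly_Mapping.lookup (\<psi> (witt_e (i + j))) (2 * i + j) = 0"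
    using j by (intro support) simp
  moreover have "Poly_Mapping.lookup (\<psi> (witt_e j)) (i + j) = 0"
    using j by (intro support) simp
  ultimately have "of_int (2 * i - j) * Poly_Mapping.lookup (\<psi> (witt_e i)) (2 * i) = 0"
    by (auto simp: witt_bracket_wronskian euler_witt_e lookup_add lookup_minus lookup_euler
        laurent_scale_mult_left laurent_scale_mult_right lookup_mult_witt_e lookup_witt_e_mult
        algebra_simps)
  then have "Poly_Mapping.lookup (\<psi> (witt_e i)) (2 * i) = 0"
    using j by (metis eq_iff_diff_eq_0 mult_eq_0_iff of_int_eq_0_iff)
  with support[of _ i] show ?thesis
    by (intro poly_mapping_eqI) (metis lookup_zero)
qed

text \<open>Half-derivations form a vector space that contains all multiplications, so subtracting
  multiplication by \<open>\<phi> 1\<close> reduces the claim to half-derivations that kill \<open>1\<close>.\<close>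

lemma half_derivation_is_multiplication:
  assumes lin: "Vector_Spaces.linear laurent_scale laurent_scale \<phi>"
    and half: "\<And>x y. laurent_scale 2 (\<phi> (witt_bracket x y)) =
      witt_bracket (\<phi> x) y + witt_bracket x (\<phi> y)"
  shows "\<phi> x = \<phi> 1 * x"
proof -
  interpret Vector_Spaces.linear laurent_scale laurent_scale \<phi> by (rule lin)
  define \<psi> where "\<psi> x = \<phi> x - \<phi> 1 * x" for x
  have "\<psi> (witt_e i) = 0" for i
  proof (rule half_derivation_vanishing)
    fix x y c
    show "laurent_scale 2 (\<psi> (witt_bracket x y)) =
        witt_bracket (\<psi> x) y + witt_bracket x (\<psi> y)"
      unfolding \<psi>_def laurent.scale_right_diff_distrib half multiplication_is_half_derivation
      by (simp add: witt_bracket_wronskian euler_diff algebra_simps)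
    show "\<psi> (laurent_scale c x) = laurent_scale c (\<psi> x)"
      by (simp add: \<psi>_def scale laurent_scale_mult_right laurent.scale_right_diff_distrib)
    show "\<psi> 1 = 0"
      by (simp add: \<psi>_def)
  qed
  then have basis: "\<phi> (witt_e i) = \<phi> 1 * witt_e i" for i
    by (simp add: \<psi>_def)
  show ?thesis
    by (induction x rule: laurent_linear_induct)
      (simp_all add: zero add scale basis laurent_scale_mult_right distrib_left)
qed

section \<open>Transposed Poisson structures on the Witt algebra\<close>

lemma transposed_poisson_is_mutation:
  assumes "transposed_poisson_algebra laurent_scale mult witt_bracket"
  shows "mult = mutation (*) (mult 1 1)"
proof (intro ext)
  interpret transposed_poisson_algebra laurent_scale mult witt_bracket by fact
  have product: "bilinear_product laurent_scale mult"
    by unfold_locales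
  have factor: "mult z x = mult z 1 * x" for z x
    using bilinear_product.linear_right[OF product] transposed_leibniz
    by (rule half_derivation_is_multiplication)
  fix z x
  have "mult z 1 = mult 1 1 * z"
    using factor[of 1 z] by (simp add: commutative)
  then show "mult z x = mutation (*) (mult 1 1) z x"
    by (simp add: factor[of z x] mutation_def mult.commute)
qed

lemma poisson_mutation_trivial:
  assumes "poisson_algebra laurent_scale (mutation (*) w) witt_bracket"
  shows "w = 0"
proof -
  interpret poisson_algebra laurent_scale "mutation (*) w" witt_bracket by fact
  have leibniz_one: "euler x * w - x * euler w = euler x * w + euler x * w" for x
    using leibniz[of x 1 1]
    by (simp add: mutation_def witt_bracket_wronskian euler_one mult.commute)
  have "euler w = 0"
    using leibniz_one[of 1] by (simp add: euler_one)
  then have "witt_e 1 * w = 0"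
    using leibniz_one[of "witt_e 1"] by (simp add: euler_witt_e)
  then have "witt_e (- 1) * witt_e 1 * w = 0"
    by (simp add: mult.assoc)
  then show ?thesis
    by (simp add: witt_e_mult witt_e_zero)
qed

lemma mutation_transposed_poisson:
  assumes "mutation (*) w \<noteq> (\<lambda>x y. 0)"
  shows "transposed_poisson_algebra laurent_scale (mutation (*) w) witt_bracket"
proof -
  interpret lie_algebra laurent_scale witt_bracket by (rule lie_algebra_witt)
  show ?thesis
  proof unfold_locales
    show "\<exists>x y. mutation (*) w x y \<noteq> 0"
      using assms by (auto simp: fun_eq_iff)
    have "witt_bracket (witt_e 1) 1 = witt_e 1"
      using euler_witt_e[of 1] by (simp add: euler_def)
    moreover have "witt_e 1 \<noteq> 0"
      by (metis lookup_single_eq lookup_zero witt_e_def zero_neq_one)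
    ultimately show "\<exists>x y. witt_bracket x y \<noteq> 0"
      by metis
    show "laurent_scale 2 (mutation (*) w z (witt_bracket x y)) =
        witt_bracket (mutation (*) w z x) y + witt_bracket x (mutation (*) w z y)" for x y z
      unfolding mutation_def by (rule multiplication_is_half_derivation)
  qed (simp_all add: mutation_def laurent_scale_mult_left laurent_scale_mult_right algebra_simps)
qed

theorem theorem19:
  shows "(\<forall>mult :: laurent \<Rightarrow> laurent \<Rightarrow> laurent.
            transposed_poisson_algebra laurent_scale mult witt_bracket \<longrightarrow>
              \<not> poisson_algebra laurent_scale mult witt_bracket \<and>
              (\<exists>w \<in> laurent.span (range witt_e).
                 mult = mutation (*) w \<and>
                 (\<forall>i j. mult (witt_e i) (witt_e j) = witt_e i * w * witt_e j))) \<and>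
         (\<forall>w :: laurent. mutation (*) w \<noteq> (\<lambda>x y. 0) \<longrightarrow>
            transposed_poisson_algebra laurent_scale (mutation (*) w) witt_bracket)"
proof (intro conjI allI impI)
  fix mult :: "laurent \<Rightarrow> laurent \<Rightarrow> laurent"
  assume tp: "transposed_poisson_algebra laurent_scale mult witt_bracket"
  then interpret transposed_poisson_algebra laurent_scale mult witt_bracket .
  define w where "w = mult 1 1"
  have mutation: "mult = mutation (*) w"
    unfolding w_def using tp by (rule transposed_poisson_is_mutation)
  have "w \<noteq> 0"
    using mult_nonzero by (auto simp: mutation mutation_def)
  then show "\<not> poisson_algebra laurent_scale mult witt_bracket"
    using poisson_mutation_trivial by (auto simp: mutation)
  have "w \<in> laurent.span (range witt_e)"
    by (simp add: span_witt_e)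
  moreover have "mult (witt_e i) (witt_e j) = witt_e i * w * witt_e j" for i j
    by (simp add: mutation mutation_def)
  ultimately show "\<exists>w \<in> laurent.span (range witt_e). mult = mutation (*) w \<and>
      (\<forall>i j. mult (witt_e i) (witt_e j) = witt_e i * w * witt_e j)"
    using mutation by blast
next
  fix w :: laurent
  assume "mutation (*) w \<noteq> (\<lambda>x y. 0)"
  then show "transposed_poisson_algebra laurent_scale (mutation (*) w) witt_bracket"
    by (rule mutation_transposed_poisson)
qed

end
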